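(* Let $\mathcal{A}$ be a central, essential arrangement of hyperplanes in $\mathbb{C}^n$ with complement $M(\mathcal{A})$. For each flat $X\in L(\mathcal{A})$, the homology class $a_X=[\gamma_X]\in H_1(M(\mathcal{A}),\mathbb{Z})$ satisfies $$a_X=\sum_{H\in\mathcal{A}:\,H\leq X} a_H .$$
   Context: Central means all hyperplanes contain $0$; essential means their intersection is $\{0\}$. $M(\mathcal{A})=\mathbb{C}^n\setminus\bigcup_{H\in\mathcal{A}}H$. $L(\mathcal{A})$ is the lattice of all intersections of hyperplanes (flats), ordered by reverse inclusion, so $H\le X$ means $X\subseteq H$. For a flat $X$, $\mathcal{A}_X=\{H\in\mathcal{A}: H\le X\}$. Construction of $\gamma_X$. Fix a basepoint $x_V\in M(\mathcal{A})$ sufficiently close to $0$. For a flat $X$ let $i_X\colon M(\mathcal{A})\to M(\mathcal{A}_X)$ be the inclusion. Choose $x_X$ in the relative interior of $X$ (i.e. in $X$ but in no hyperplane not containing $X$) such that the real interval $[x_V,x_X]$ meets only hyperplanes of $\mathcal{A}_X$. Let $B_X$ be the Minkowski sum of $[x_V,x_X]$ with a closed ball of radius $\epsilon$ so small that $B_X\cap H\neq\emptyset$ iff $H\le X$. Let $q_X\colon M(\mathcal{A}_X)\to B_X\cap M(\mathcal{A})$ be the identity on $B_X\cap M(\mathcal{A}_X)$ and radial projection (toward $x_X$) to $\partial B_X$ elsewhere, and let $r_X\colon M(\mathcal{A}_X)\to M(\mathcal{A})$ be $q_X$ followed by inclusion; it preserves the basepoint. Let $\gamma_0\in\pi_1(M(\mathcal{A}),x_V)$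 be the class of the loop $t\mapsto e^{2\pi i t}x_V$ (the image of the generator of $\pi_1(\mathbb{C}^*,1)$ under inclusion of the Hopf fiber through $x_V$), and let $\gamma_0^X\in\pi_1(M(\mathcal{A}_X),x_V)$ be the class of the same loop in $M(\mathcal{A}_X)$. Put $\gamma_X=(r_X)_\sharp(\gamma_0^X)\in\pi_1(M(\mathcal{A}),x_V)$. *)

theory Defs
  imports "HOL-Analysis.Analysis" "HOL-Homology.Homology"
begin

section \<open>Complex hyperplane arrangements\<close>

definition complex_hyperplane :: "(complex ^ 'n) set \<Rightarrow> bool" where
  "complex_hyperplane H \<longleftrightarrow> (\<exists>a b. a \<noteq> 0 \<and> H = {z. (\<Sum>i\<in>UNIV. a $ i * z $ i) = b})"

definition arrangement :: "(complex ^ 'n) set set \<Rightarrow> bool" where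
  "arrangement A \<longleftrightarrow> finite A \<and> (\<forall>H\<in>A. complex_hyperplane H)"

definition central_arr :: "(complex ^ 'n) set set \<Rightarrow> bool" where
  "central_arr A \<longleftrightarrow> (\<forall>H\<in>A. 0 \<in> H)"

definition essential_arr :: "(complex ^ 'n) set set \<Rightarrow> bool" where
  "essential_arr A \<longleftrightarrow> \<Inter>A = {0}"

definition arr_complement :: "(complex ^ 'n) set set \<Rightarrow> (complex ^ 'n) set" where
  "arr_complement A = - \<Union>A"

text \<open>The empty subset of \<open>A\<close> is allowed and contributes the whole space as a flat.\<close>

definition flats :: "(complex ^ 'n) set set \<Rightarrow> (complex ^ 'n) set set" where
  "flats A = {\<Inter>B | B. B \<subseteq> A}"

definition arr_localization :: "(complex ^ 'n) set set \<Rightarrow> (complex ^ 'n) set \<Rightarrow> (complex ^ 'n) set set" where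
  "arr_localization A X = {H \<in> A. X \<subseteq> H}"


section \<open>Fundamental group and first homology\<close>

text \<open>
  An element of the fundamental group of \<open>S\<close> is represented as the set of all loops in one
  class of homotopy relative to the endpoints. Values of paths outside \<open>{0..1}\<close> are irrelevant.
\<close>

definition pi1_class :: "'a::topological_space set \<Rightarrow> (real \<Rightarrow> 'a) \<Rightarrow> (real \<Rightarrow> 'a) set" where
  "pi1_class S g = {h. homotopic_paths S g h}"

text \<open>
  The map induced by a continuous map \<open>f\<close> into \<open>T\<close>: the sets united below all coincide when
  \<open>c\<close> is a homotopy class in the domain of \<open>f\<close>.
\<close>

definition pi1_induced ::
  "'b::topological_space set \<Rightarrow> ('a::topological_space \<Rightarrow> 'b) \<Rightarrow> (real \<Rightarrow> 'a) set \<Rightarrow> (real \<Rightarrow> 'b) set" where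
  "pi1_induced T f c = (\<Union>g\<in>c. pi1_class T (f \<circ> g))"

text \<open>
  A path viewed as a singular 1-simplex, where \<open>x 1\<close> is the second barycentric coordinate,
  so that the simplex runs from \<open>g 0\<close> to \<open>g 1\<close>.
\<close>

definition path_simplex :: "(real \<Rightarrow> 'a) \<Rightarrow> (nat \<Rightarrow> real) \<Rightarrow> 'a" where
  "path_simplex g = restrict (\<lambda>x. g (x 1)) (standard_simplex 1)"

text \<open>Elements of \<open>homology_group 1\<close> are cosets of boundaries, given by \<open>homologous_rel_set\<close>.\<close>

definition loop_homology_class :: "'a::topological_space set \<Rightarrow> (real \<Rightarrow> 'a) \<Rightarrow> 'a chain set" where
  "loop_homology_class S g = homologous_rel_set 1 (top_of_set S) {} (frag_of (path_simplex g))"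

definition hurewicz :: "'a::topological_space set \<Rightarrow> (real \<Rightarrow> 'a) set \<Rightarrow> 'a chain set" where
  "hurewicz S c = (THE a. \<forall>g\<in>c. loop_homology_class S g = a)"


section \<open>The classes attached to flats\<close>

definition thick_segment :: "complex ^ 'n \<Rightarrow> complex ^ 'n \<Rightarrow> real \<Rightarrow> (complex ^ 'n) set" where
  "thick_segment xV x \<epsilon> = {u + v | u v. u \<in> closed_segment xV x \<and> v \<in> cball 0 \<epsilon>}"

definition admissible_choice ::
  "(complex ^ 'n) set set \<Rightarrow> complex ^ 'n \<Rightarrow> (complex ^ 'n) set \<Rightarrow> complex ^ 'n \<Rightarrow> real \<Rightarrow> bool" where
  "admissible_choice A xV X x \<epsilon> \<longleftrightarrow>
     x \<in> X \<and> (\<forall>H\<in>A. \<not> X \<subseteq> H \<longrightarrow> x \<notin> H) \<and>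
     (\<forall>H\<in>A. closed_segment xV x \<inter> H \<noteq> {} \<longrightarrow> H \<in> arr_localization A X) \<and>
     \<epsilon> > 0 \<and>
     (\<forall>H\<in>A. thick_segment xV x \<epsilon> \<inter> H \<noteq> {} \<longleftrightarrow> X \<subseteq> H)"

text \<open>
  For \<open>B\<close> convex and compact with \<open>x\<close> in its interior, the segment from \<open>x\<close> to a point outside
  \<open>B\<close> meets the boundary of \<open>B\<close> exactly once.
\<close>

definition radial_retraction :: "'a::euclidean_space \<Rightarrow> 'a set \<Rightarrow> 'a \<Rightarrow> 'a" where
  "radial_retraction x B z =
     (if z \<in> B then z else (THE w. w \<in> closed_segment x z \<and> w \<in> frontier B))"

definition hopf_loop :: "complex ^ 'n \<Rightarrow> real \<Rightarrow> complex ^ 'n" where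
  "hopf_loop xV t = exp (2 * of_real pi * \<i> * of_real t) *s xV"

text \<open>
  \<open>x\<close> and \<open>\<epsilon>\<close> are the point chosen in the flat \<open>X\<close> and the radius of the thickening.
  The retraction is used here as a map from \<open>arr_complement (arr_localization A X)\<close>
  to \<open>arr_complement A\<close>.
\<close>

definition gamma_flat ::
  "(complex ^ 'n) set set \<Rightarrow> complex ^ 'n \<Rightarrow> (complex ^ 'n) set \<Rightarrow> complex ^ 'n \<Rightarrow> real
     \<Rightarrow> (real \<Rightarrow> complex ^ 'n) set" where
  "gamma_flat A xV X x \<epsilon> =
     pi1_induced (arr_complement A) (radial_retraction x (thick_segment xV x \<epsilon>))
       (pi1_class (arr_complement (arr_localization A X)) (hopf_loop xV))"

definition homology_flat ::
  "(complex ^ 'n) set set \<Rightarrow> complex ^ 'n \<Rightarrow> (complex ^ 'n) set \<Rightarrow> complex ^ 'n \<Rightarrow> real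
     \<Rightarrow> (complex ^ 'n) chain set" where
  "homology_flat A xV X x \<epsilon> = hurewicz (arr_complement A) (gamma_flat A xV X x \<epsilon>)"

end

theory Submission
  imports Defs "HOL-Complex_Analysis.Complex_Analysis"
begin

text \<open>
  Write \<open>u\<close> for the base point \<open>xV\<close>. A hyperplane \<open>H\<close> of a central arrangement does not contain \<open>u\<close>,
  so it is the kernel of a unique linear form with value \<open>1\<close> at \<open>u\<close>; on the complex line
  \<open>p + w u\<close> this form is \<open>w\<close> plus a constant. All loops below are circles in lines of this direction.

  The class of a flat is the class of a small circle. In the complement of the localization at \<open>X\<close>, the Hopf
  loop slides to the circle of radius \<open>\<delta>\<close> around \<open>x X\<close> in direction \<open>u\<close>: along the way each
  hyperplane through \<open>X\<close> sees only a positive multiple of \<open>exp (2 * pi * \<i> * t)\<close>. The radial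
  retraction is continuous and fixes the small circle, so the image of the Hopf loop is freely homotopic to it
  (\<open>homology_flat_small_circle\<close>). Free homotopies preserve homology classes.

  The small circle is a sum of meridians. Its centre lies on every hyperplane through \<open>X\<close>. Replace the circle by
  the boundary of a square and push the square a little in a generic direction \<open>v\<close>. The boundary of the square
  meets no hyperplane during the push, and afterwards the hyperplanes through \<open>X\<close> cut the square in distinct interior
  points, one for each hyperplane. Cutting the square along lines between these points shows that its boundary
  is homologous to the sum of small circles around them (\<open>rect_boundary_homologous_circles\<close>).

  Finally, a small circle around a point of \<open>H\<close> that lies on no other hyperplane can be moved to any
  other such point, because \<open>H\<close> minus the other hyperplanes is path connected (\<open>meridians_homotopic\<close>). One such
  point is \<open>x H\<close>, and the circle there represents the class of the flat \<open>H\<close>.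
\<close>

section \<open>First homology classes of loops\<close>

abbreviation homologous :: "'a::topological_space set \<Rightarrow> 'a chain \<Rightarrow> 'a chain \<Rightarrow> bool" where
  "homologous S \<equiv> homologous_rel 1 (top_of_set S) {}"

abbreviation path_chain :: "(real \<Rightarrow> 'a) \<Rightarrow> 'a chain" where
  "path_chain g \<equiv> frag_of (path_simplex g)"

lemma path_simplex_cong:
  assumes "\<And>t. t \<in> {0..1} \<Longrightarrow> g t = h t"
  shows "path_simplex g = path_simplex h"
  unfolding path_simplex_def
  by (rule restrict_ext) (auto simp: standard_simplex_def assms)

lemma homologous_common:
  assumes "homologous S a c" "homologous S b c"
  shows "homologous S a b"
  using assms(1) assms(2)[unfolded homologous_rel_sym[of _ _ _ b]] by (rule homologous_rel_trans[rotated])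

text \<open>The singular 2-simplex that follows \<open>f\<close> over the triangle \<open>a\<close>, \<open>b\<close>, \<open>c\<close> has the difference of the
two chains as its boundary. The triangle may be degenerate. Every homology between paths
in this theory is assembled from such simplices.\<close>

lemma homologous_triangle:
  fixes f :: "'b::real_normed_vector \<Rightarrow> 'a::topological_space"
  assumes K: "convex K" "a \<in> K" "b \<in> K" "c \<in> K"
    and f: "continuous_on K f" "f ` K \<subseteq> S"
  shows "homologous S
    (path_chain (f \<circ> linepath a b) + path_chain (f \<circ> linepath b c)) (path_chain (f \<circ> linepath a c))"
proof -
  define l where "l = (\<lambda>x::nat\<Rightarrow>real. x 0 *\<^sub>R a + x 1 *\<^sub>R b + x 2 *\<^sub>R c)"
  define \<sigma> where "\<sigma> = restrict (f \<circ> l) (standard_simplex 2)"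
  have three: "{..2::nat} = {0,1,2}" by auto
  have lK: "l ` standard_simplex 2 \<subseteq> K"
  proof clarify
    fix x assume "x \<in> standard_simplex 2"
    then have "\<forall>i. 0 \<le> x i" "x 0 + x 1 + x 2 = 1"
      by (auto simp: standard_simplex_def three)
    then have "l x \<in> convex hull {a, b, c}"
      unfolding convex_hull_3 l_def by blast
    then show "l x \<in> K"
      using K hull_minimal[of "{a, b, c}" K convex] by auto
  qed
  have "continuous_on (standard_simplex 2) l"
    unfolding l_def by (intro continuous_intros continuous_on_product_coordinates continuous_on_subset[OF continuous_on_product_coordinates]) auto
  then have "continuous_on (standard_simplex 2) (f \<circ> l)"
    using f lK by (meson continuous_on_compose continuous_on_subset)
  then have sing: "singular_simplex 2 (top_of_set S) \<sigma>"
    unfolding singular_simplex_def \<sigma>_def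
    using f lK by (auto simp: euclidean_product_topology image_subset_iff)
  have face: "singular_face 2 0 \<sigma> = path_simplex (f \<circ> linepath b c)"
    "singular_face 2 1 \<sigma> = path_simplex (f \<circ> linepath a c)"
    "singular_face 2 2 \<sigma> = path_simplex (f \<circ> linepath a b)"
  proof -
    have x0: "x 0 = 1 - x 1" if "x \<in> standard_simplex 1" for x :: "nat \<Rightarrow> real"
      using that by (auto simp: standard_simplex_def)
    have mem: "simplical_face k x \<in> standard_simplex 2"
      if "x \<in> standard_simplex 1" "k \<le> 2" for x :: "nat \<Rightarrow> real" and k
      using that simplical_face_in_standard_simplex[of 2 k x] by simp
    have \<sigma>_face: "\<sigma> (simplical_face k x) = f (l (simplical_face k x))"
      if "x \<in> standard_simplex 1" "k \<le> 2" for x k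
      using mem[OF that] by (simp add: \<sigma>_def)
    have l_face: "l (simplical_face 0 x) = linepath b c (x 1)" "l (simplical_face 1 x) = linepath a c (x 1)"
      "l (simplical_face 2 x) = linepath a b (x 1)" if "x \<in> standard_simplex 1" for x
      using x0[OF that] by (simp_all add: l_def linepath_def simplical_face_def)
    show "singular_face 2 0 \<sigma> = path_simplex (f \<circ> linepath b c)"
      "singular_face 2 1 \<sigma> = path_simplex (f \<circ> linepath a c)"
      "singular_face 2 2 \<sigma> = path_simplex (f \<circ> linepath a b)"
      unfolding singular_face_def path_simplex_def
      by (auto intro!: restrict_ext simp: \<sigma>_face l_face[unfolded One_nat_def])
  qed
  have "chain_boundary 2 (frag_of \<sigma>) = path_chain (f \<circ> linepath a b) + path_chain (f \<circ> linepath b c)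
      - path_chain (f \<circ> linepath a c)"
    by (simp add: chain_boundary_of three face face(2)[unfolded One_nat_def])
  then show ?thesis
    unfolding homologous_rel_def singular_boundary
    using sing by (metis One_nat_def Suc_1 singular_chain_of)
qed

lemma homologous_path_split:
  assumes p: "path p" "path_image p \<subseteq> S" and u: "0 \<le> u" "u \<le> 1"
  shows "homologous S (path_chain (p \<circ> linepath 0 u) + path_chain (p \<circ> linepath u 1)) (path_chain p)"
proof -
  have "path_simplex (p \<circ> linepath 0 1) = path_simplex p"
    by (rule path_simplex_cong) (simp add: linepath_def)
  then show ?thesis
    using homologous_triangle[of "{0..1}" 0 u 1 p S] p u
    by (auto simp: path_def path_image_def)
qed

lemma homologous_join:
  assumes "path p" "path q" "pathfinish p = pathstart q" "path_image p \<subseteq> S" "path_image q \<subseteq> S"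
  shows "homologous S (path_chain (p +++ q)) (path_chain p + path_chain q)"
proof -
  have "path_simplex ((p +++ q) \<circ> linepath 0 (1/2)) = path_simplex p"
    by (rule path_simplex_cong) (auto simp: linepath_def joinpaths_def)
  moreover have "path_simplex ((p +++ q) \<circ> linepath (1/2) 1) = path_simplex q"
    using assms(3)
    by (intro path_simplex_cong) (auto simp: linepath_def joinpaths_def pathstart_def pathfinish_def field_simps)
  ultimately show ?thesis
    using homologous_path_split[of "p +++ q" S "1/2"] assms
    by (simp add: homologous_rel_sym path_image_join)
qed

lemma homologous_constant:
  assumes "x \<in> S"
  shows "homologous S (path_chain (\<lambda>_. x)) 0"
  using homologous_triangle[of "{0}" 0 0 0 "\<lambda>_::real. x" S] assms
  by (auto simp: homologous_rel_def o_def)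

lemma homologous_reverse_edge:
  fixes f :: "'b::real_normed_vector \<Rightarrow> 'a::topological_space"
  assumes "convex K" "a \<in> K" "b \<in> K" "continuous_on K f" "f ` K \<subseteq> S"
  shows "homologous S (path_chain (f \<circ> linepath b a)) (- path_chain (f \<circ> linepath a b))"
proof -
  have "f \<circ> linepath a a = (\<lambda>_. f a)"
    by (auto simp: linepath_refl)
  then have "homologous S (path_chain (f \<circ> linepath a b) + path_chain (f \<circ> linepath b a)) 0"
    using homologous_triangle[of K a b a f S] homologous_constant[of "f a" S] assms
    by (metis homologous_rel_trans image_subset_iff)
  then show ?thesis
    by (simp add: homologous_rel_def add.commute)
qed

text \<open>The diagonal divides the square of the homotopy into two triangles. The two vertical sides are the same
path since every stage of the homotopy is a loop, so they cancel.\<close>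

lemma homologous_homotopic_loops:
  assumes "homotopic_loops S p q"
  shows "homologous S (path_chain p) (path_chain q)"
proof -
  let ?Q = "{0..1::real} \<times> {0..1::real}"
  obtain h where h: "continuous_on ?Q h" "h ` ?Q \<subseteq> S"
    and h0: "\<And>t. t \<in> {0..1} \<Longrightarrow> h (0, t) = p t" and h1: "\<And>t. t \<in> {0..1} \<Longrightarrow> h (1, t) = q t"
    and loop: "\<And>s. s \<in> {0..1} \<Longrightarrow> h (s, 1) = h (s, 0)"
    using assms unfolding homotopic_loops pathstart_def pathfinish_def o_def image_subset_iff_funcset
    by blast
  have cvx: "convex ?Q"
    by (intro convex_Times) auto
  have edges: "path_simplex (h \<circ> linepath (0,0) (0,1)) = path_simplex p"
    "path_simplex (h \<circ> linepath (1,0) (1,1)) = path_simplex q"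
    "path_simplex (h \<circ> linepath (0,1) (1,1)) = path_simplex (h \<circ> linepath (0,0) (1,0))"
    by (auto intro!: path_simplex_cong simp: linepath_def h0 h1 loop)
  have "homologous S (path_chain p + path_chain (h \<circ> linepath (0,0) (1,0)))
      (path_chain (h \<circ> linepath (0,0) (1,1)))"
    using homologous_triangle[OF cvx _ _ _ h, of "(0,0)" "(0,1)" "(1,1)"] by (simp add: edges)
  moreover have "homologous S (path_chain (h \<circ> linepath (0,0) (1,0)) + path_chain q)
      (path_chain (h \<circ> linepath (0,0) (1,1)))"
    using homologous_triangle[OF cvx _ _ _ h, of "(0,0)" "(1,0)" "(1,1)"] by (simp add: edges)
  ultimately have "homologous S (path_chain p + path_chain (h \<circ> linepath (0,0) (1,0)))
     (path_chain (h \<circ> linepath (0,0) (1,0)) + path_chain q)"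
    by (metis homologous_common)
  then show ?thesis
    by (simp add: homologous_rel_def)
qed

lemma singular_relcycle_loop:
  assumes "path g" "path_image g \<subseteq> S" "pathfinish g = pathstart g"
  shows "singular_relcycle 1 (top_of_set S) {} (path_chain g)"
proof -
  have "continuous_on (standard_simplex 1) (\<lambda>x. x 1)"
    by (rule continuous_on_subset[OF continuous_on_product_coordinates]) auto
  moreover have 01: "(\<lambda>x. x 1) ` standard_simplex 1 \<subseteq> {0..1}"
    by (auto simp: standard_simplex_def)
  ultimately have "continuous_on (standard_simplex 1) (\<lambda>x. g (x 1))"
    using assms(1) unfolding path_def by (rule continuous_on_compose2[rotated])
  then have "singular_simplex 1 (top_of_set S) (path_simplex g)"
    using 01 assms(2) unfolding singular_simplex_def path_simplex_def
    by (auto simp: euclidean_product_topology path_image_def)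
  moreover have "singular_face 1 0 (path_simplex g) = singular_face 1 1 (path_simplex g)"
    unfolding singular_face_def path_simplex_def using assms(3)
    by (auto intro!: restrict_ext simp: standard_simplex_0 simplical_face_def standard_simplex_def
        pathstart_def pathfinish_def)
  moreover have "{..1::nat} = {0,1}" by auto
  ultimately show ?thesis
    by (simp add: singular_cycle singular_chain_of chain_boundary_of)
qed

lemma finprod_homology_classes:
  fixes X :: "'a topology" and p :: nat
  assumes "finite I" "\<And>i. i \<in> I \<Longrightarrow> singular_relcycle p X {} (c i)"
  shows "finprod (homology_group (int p) X) (\<lambda>i. homologous_rel_set p X {} (c i)) I
    = homologous_rel_set p X {} (sum c I)"
  using assms
proof (induction I rule: finite_induct)
  case empty
  interpret comm_group "homology_group (int p) X"
    by (rule abelian_relative_homology_group)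
  have "homologous_rel_set p X {} 0 = singular_relboundary_set p X {}"
    by (simp add: homologous_rel_set_eq_relboundary)
  then show ?case
    by simp
next
  case (insert i I)
  interpret comm_group "homology_group (int p) X"
    by (rule abelian_relative_homology_group)
  have car: "homologous_rel_set p X {} (c j) \<in> carrier (homology_group (int p) X)" if "j \<in> insert i I" for j
    using that insert.prems by (auto simp: carrier_relative_homology_group)
  have mult: "homologous_rel_set p X {} a \<otimes>\<^bsub>homology_group (int p) X\<^esub> homologous_rel_set p X {} b
      = homologous_rel_set p X {} (a + b)" for a b
  proof -
    have "\<exists>r s. homologous_rel p X {} a r \<and> homologous_rel p X {} b s \<and> z = r + s"
      if "homologous_rel p X {} (a + b) z" for z
      using that by (intro exI[of _ a] exI[of _ "z - a"]) (simp add: homologous_rel_def algebra_simps)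
    then show ?thesis
      by (auto simp: mult_relative_homology_group intro: homologous_rel_add)
  qed
  show ?case
    using insert car by (subst finprod_insert) (auto simp: mult)
qed

section \<open>Radial retraction onto a convex body\<close>

text \<open>All points of a segment from an interior point to a point of the closure are interior, except possibly
the last. Hence of two distinct frontier points on one ray the nearer one would be interior.\<close>

lemma segment_frontier_unique:
  fixes B :: "'a::euclidean_space set"
  assumes B: "convex B" "x \<in> interior B"
    and w: "w \<in> closed_segment x z" "w \<in> frontier B"
    and w': "w' \<in> closed_segment x z" "w' \<in> frontier B"
  shows "w = w'"
proof -
  have less: "\<not> s < t"
    if "x + s *\<^sub>R (z - x) \<in> frontier B" "x + t *\<^sub>R (z - x) \<in> frontier B" "0 \<le> s" for s t
  proof
    assume "s < t"
    let ?w = "x + s *\<^sub>R (z - x)" and ?w' = "x + t *\<^sub>R (z - x)"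
    have "?w \<noteq> x" "?w' \<noteq> x"
      using that B by (auto simp: frontier_def)
    then have "s > 0"
      using that by (cases "s = 0") auto
    have "?w = (1 - s / t) *\<^sub>R x + (s / t) *\<^sub>R ?w'"
      using \<open>s < t\<close> \<open>s > 0\<close> by (simp add: algebra_simps)
    then have "?w \<in> open_segment x ?w'"
      using \<open>s < t\<close> \<open>s > 0\<close> \<open>?w' \<noteq> x\<close> unfolding in_segment by (intro conjI exI[of _ "s/t"]) auto
    then have "?w \<in> interior B"
      using in_interior_closure_convex_segment[OF B, of ?w'] that by (auto simp: frontier_def)
    then show False
      using that by (auto simp: frontier_def)
  qed
  obtain s t where st: "0 \<le> s" "0 \<le> t" "w = x + s *\<^sub>R (z - x)" "w' = x + t *\<^sub>R (z - x)"
    using w w' unfolding in_segment by (auto simp: algebra_simps)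
  then show ?thesis
    using less[of s t] less[of t s] w w' by (metis linorder_neqE)
qed

lemma radial_retraction_outside:
  fixes B :: "'a::euclidean_space set"
  assumes "convex B" "x \<in> interior B" "z \<notin> B"
  shows "radial_retraction x B z \<in> closed_segment x z" "radial_retraction x B z \<in> frontier B"
proof -
  have "x \<in> B"
    using assms interior_subset by blast
  then have "closed_segment x z \<inter> frontier B \<noteq> {}"
    using assms by (intro connected_Int_frontier) auto
  then have "\<exists>!w. w \<in> closed_segment x z \<and> w \<in> frontier B"
    using segment_frontier_unique[OF assms(1,2)] by blast
  from theI'[OF this] show "radial_retraction x B z \<in> closed_segment x z" "radial_retraction x B z \<in> frontier B"
    using assms by (auto simp: radial_retraction_def)
qed

lemma radial_retraction_inside [simp]: "z \<in> B \<Longrightarrow> radial_retraction x B z = z"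
  by (simp add: radial_retraction_def)

text \<open>A map into a compact set is continuous once its graph is closed. By the uniqueness of the frontier point, the graph
is the diagonal of \<open>B\<close> together with the pairs \<open>(z, w)\<close> where \<open>z\<close> is not interior and
\<open>w\<close> is a frontier point on the segment from \<open>x\<close> to \<open>z\<close>; membership in a segment is the closed
condition of equality in the triangle inequality.\<close>

lemma continuous_on_radial_retraction:
  fixes B :: "'a::euclidean_space set"
  assumes B: "convex B" "compact B" "x \<in> interior B"
  shows "continuous_on UNIV (radial_retraction x B)"
proof (rule continuous_from_closed_graph)
  let ?r = "radial_retraction x B"
  have clB: "closed B" "frontier B \<subseteq> B"
    using B compact_imp_closed frontier_subset_compact by blast+
  show "?r \<in> UNIV \<rightarrow> B"
    using radial_retraction_outside[OF B(1,3)] clB by (metis Pi_I radial_retraction_inside subsetD)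
  have graph: "(z, w) \<in> range (\<lambda>z. (z, ?r z)) \<longleftrightarrow>
      z = w \<and> z \<in> B \<or> z \<notin> interior B \<and> w \<in> frontier B \<and> w \<in> closed_segment x z" for z w
  proof (cases "z \<in> B")
    case True
    then have "w = z" if "z \<notin> interior B" "w \<in> frontier B" "w \<in> closed_segment x z"
      using segment_frontier_unique[OF B(1,3), of w z z] that clB by (auto simp: frontier_def)
    then show ?thesis
      using True by auto
  next
    case False
    then have "z \<notin> interior B"
      using interior_subset by blast
    then show ?thesis
      using False radial_retraction_outside[OF B(1,3) False]
        segment_frontier_unique[OF B(1,3), of w z "?r z"] by auto
  qed
  have "range (\<lambda>z. (z, ?r z)) = {p. fst p = snd p} \<inter> (B \<times> UNIV) \<union>
     ((- interior B) \<times> frontier B) \<inter> {p. dist x (fst p) = dist x (snd p) + dist (snd p) (fst p)}"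
    unfolding set_eq_iff split_paired_All graph
    by (auto simp: between_mem_segment[symmetric] between)
  also have "closed \<dots>"
    using clB by (intro closed_Un closed_Int closed_Times closed_Collect_eq continuous_intros)
      (auto simp: closed_Compl)
  finally show "closed (range (\<lambda>z. (z, ?r z)))" .
qed (use B in auto)

section \<open>The boundary of a rectangle and circles around points inside it\<close>

text \<open>Both loops wind once around \<open>z\<close>, so they are homotopic in the plane without \<open>z\<close>. Radial retraction
with centre \<open>z\<close> brings this homotopy into the rectangle and fixes both loops.\<close>

lemma rectpath_homotopic_circlepath:
  assumes z: "z \<in> box a b" and \<delta>: "0 < \<delta>" "cball z \<delta> \<subseteq> cbox a b"
  shows "homotopic_loops (cbox a b - {z}) (rectpath a b) (circlepath z \<delta>)"
proof -
  let ?K = "cbox a b" and ?r = "radial_retraction z (cbox a b)"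
  have ab: "Re a < Re b" "Im a < Im b"
    using z by (auto simp: in_box_complex_iff)
  have rect: "path_image (rectpath a b) = cbox a b - box a b"
    using ab by (intro path_image_rectpath_cbox_minus_box) auto
  have circ: "path_image (circlepath z \<delta>) \<subseteq> cball z \<delta> - {z}"
    using \<delta> by (auto simp: sphere_def)
  have "homotopic_loops (- {z}) (rectpath a b) (circlepath z \<delta>)"
    using z \<delta> rect by (subst winding_number_homotopic_loops_eq[symmetric])
      (auto simp: winding_number_rectpath winding_number_circlepath_centre)
  moreover have "?r \<in> - {z} \<rightarrow> ?K - {z}"
  proof
    fix y assume "y \<in> - {z}"
    then show "?r y \<in> ?K - {z}"
      using radial_retraction_outside[of ?K z y] z
      by (cases "y \<in> ?K") (auto simp: interior_cbox frontier_cbox)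
  qed
  moreover have "continuous_on (- {z}) ?r"
    using z by (intro continuous_on_subset[OF continuous_on_radial_retraction])
      (auto simp: interior_cbox convex_box)
  ultimately have "homotopic_loops (?K - {z}) (?r \<circ> rectpath a b) (?r \<circ> circlepath z \<delta>)"
    by (intro homotopic_loops_continuous_image)
  moreover have inK: "rectpath a b t \<in> ?K" "circlepath z \<delta> t \<in> ?K" if "t \<in> {0..1}" for t
    using rect circ \<delta> that unfolding path_image_def by blast+
  moreover have "homotopic_loops (?K - {z}) (rectpath a b) (?r \<circ> rectpath a b)"
    using rect z by (intro homotopic_loops_eq) (auto simp: inK)
  moreover have "homotopic_loops (?K - {z}) (circlepath z \<delta>) (?r \<circ> circlepath z \<delta>)"
    using circ \<delta> by (intro homotopic_loops_eq) (auto simp: inK)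
  ultimately show ?thesis
    by (meson homotopic_loops_sym homotopic_loops_trans)
qed

text \<open>A sum of four edges rather than the single loop \<open>g \<circ> rectpath a b\<close>, so that edges shared by adjacent
rectangles cancel.\<close>

definition rect_boundary :: "(complex \<Rightarrow> 'a) \<Rightarrow> complex \<Rightarrow> complex \<Rightarrow> 'a chain" where
  "rect_boundary g a b =
     path_chain (g \<circ> linepath a (Complex (Re b) (Im a))) +
     path_chain (g \<circ> linepath (Complex (Re b) (Im a)) b) +
     path_chain (g \<circ> linepath b (Complex (Re a) (Im b))) +
     path_chain (g \<circ> linepath (Complex (Re a) (Im b)) a)"

lemma homologous_rectpath:
  assumes ab: "Re a \<le> Re b" "Im a \<le> Im b"
    and g: "continuous_on (cbox a b - box a b) g" "g ` (cbox a b - box a b) \<subseteq> S"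
  shows "homologous S (path_chain (g \<circ> rectpath a b)) (rect_boundary g a b)"
proof -
  let ?c = "Complex (Re b) (Im a)" and ?d = "Complex (Re a) (Im b)"
  have im: "path_image (rectpath a b) = cbox a b - box a b"
    using ab by (intro path_image_rectpath_cbox_minus_box) auto
  then have un: "cbox a b - box a b = closed_segment a ?c \<union> closed_segment ?c b \<union> closed_segment b ?d \<union> closed_segment ?d a"
    by (simp add: rectpath_def Let_def path_image_join Un_assoc)
  have g': "path (g \<circ> linepath u v)" "path_image (g \<circ> linepath u v) \<subseteq> S"
    if "closed_segment u v \<subseteq> cbox a b - box a b" for u v
    using g that by (auto intro!: path_continuous_image continuous_on_subset[OF g(1)] simp: path_image_compose)
  note edges = g'[of a ?c] g'[of ?c b] g'[of b ?d] g'[of ?d a]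
  let ?p1 = "g \<circ> linepath a ?c" and ?p2 = "g \<circ> linepath ?c b" and ?p3 = "g \<circ> linepath b ?d" and ?p4 = "g \<circ> linepath ?d a"
  have 3: "homologous S (path_chain (?p3 +++ ?p4)) (path_chain ?p3 + path_chain ?p4)"
    using edges un by (intro homologous_join) (auto simp: pathstart_compose pathfinish_compose)
  have 2: "homologous S (path_chain (?p2 +++ ?p3 +++ ?p4)) (path_chain ?p2 + path_chain (?p3 +++ ?p4))"
    using edges un by (intro homologous_join path_join_imp)
      (auto simp: pathstart_compose pathfinish_compose path_image_join)
  have 1: "homologous S (path_chain (?p1 +++ ?p2 +++ ?p3 +++ ?p4)) (path_chain ?p1 + path_chain (?p2 +++ ?p3 +++ ?p4))"
    using edges un by (intro homologous_join path_join_imp)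
      (auto simp: pathstart_compose pathfinish_compose path_image_join)
  have "g \<circ> rectpath a b = ?p1 +++ ?p2 +++ ?p3 +++ ?p4"
    by (simp add: rectpath_def Let_def path_compose_join)
  moreover have "homologous S (path_chain (?p1 +++ ?p2 +++ ?p3 +++ ?p4)) (path_chain ?p1 + (path_chain ?p2 + (path_chain ?p3 + path_chain ?p4)))"
    by (rule homologous_rel_trans[OF homologous_rel_add[OF homologous_rel_refl
          homologous_rel_trans[OF homologous_rel_add[OF homologous_rel_refl 3] 2]] 1])
  ultimately show ?thesis
    by (simp add: rect_boundary_def add.assoc)
qed

lemma rect_boundary_null_homologous:
  assumes ab: "Re a \<le> Re b" "Im a \<le> Im b"
    and g: "continuous_on (cbox a b) g" "g ` cbox a b \<subseteq> S"
  shows "homologous S (rect_boundary g a b) 0"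
proof -
  let ?c = "Complex (Re b) (Im a)" and ?d = "Complex (Re a) (Im b)"
  have K: "convex (cbox a b)" "a \<in> cbox a b" "b \<in> cbox a b" "?c \<in> cbox a b" "?d \<in> cbox a b"
    using ab by (auto simp: in_cbox_complex_iff convex_box)
  have "homologous S (path_chain (g \<circ> linepath a ?c) + path_chain (g \<circ> linepath ?c b)) (path_chain (g \<circ> linepath a b))"
    "homologous S (path_chain (g \<circ> linepath b ?d) + path_chain (g \<circ> linepath ?d a)) (path_chain (g \<circ> linepath b a))"
    "homologous S (path_chain (g \<circ> linepath b a)) (- path_chain (g \<circ> linepath a b))"
    using homologous_triangle[OF K(1,2,4,3) g] homologous_triangle[OF K(1,3,5,2) g]
      homologous_reverse_edge[OF K(1,2,3) g] .
  then have "homologous S (path_chain (g \<circ> linepath a ?c) + path_chain (g \<circ> linepath ?c b) +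
      (path_chain (g \<circ> linepath b ?d) + path_chain (g \<circ> linepath ?d a)))
      (path_chain (g \<circ> linepath a b) + (- path_chain (g \<circ> linepath a b)))"
    by (blast intro: homologous_rel_add homologous_rel_trans)
  then show ?thesis
    by (simp add: rect_boundary_def add.assoc)
qed

text \<open>The vertical cut at abscissa \<open>c\<close> is traversed once in each direction and cancels.\<close>

lemma rect_boundary_cut:
  assumes c: "Re a \<le> c" "c \<le> Re b" and ab: "Im a \<le> Im b"
    and T: "cbox a b - box a b \<subseteq> T" "closed_segment (Complex c (Im a)) (Complex c (Im b)) \<subseteq> T"
    and g: "continuous_on T g" "g ` T \<subseteq> S"
  shows "homologous S (rect_boundary g a b)
     (rect_boundary g a (Complex c (Im b)) + rect_boundary g (Complex c (Im a)) b)"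
proof -
  let ?m = "Complex c (Im a)" and ?n = "Complex c (Im b)"
  let ?c = "Complex (Re b) (Im a)" and ?d = "Complex (Re a) (Im b)"
  define e where "e u v = path_chain (g \<circ> linepath u v)" for u v
  have sub: "closed_segment a ?c \<subseteq> T" "closed_segment b ?d \<subseteq> T"
    using T c ab path_image_rectpath_cbox_minus_box[of a b]
    by (auto simp: rectpath_def Let_def path_image_join)
  have "?m \<in> closed_segment a ?c" "?n \<in> closed_segment b ?d"
    using c by (auto simp: closed_segment_same_Im closed_segment_same_Re closed_segment_eq_real_ivl)
  then have "homologous S (e a ?m + e ?m ?c) (e a ?c)" "homologous S (e b ?n + e ?n ?d) (e b ?d)"
    unfolding e_def
    using homologous_triangle[of "closed_segment a ?c" a ?m ?c g S] homologous_triangle[of "closed_segment b ?d" b ?n ?d g S]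
      sub g continuous_on_subset[OF g(1)] by blast+
  moreover have "homologous S (e ?n ?m) (- e ?m ?n)"
    unfolding e_def
    using homologous_reverse_edge[of "closed_segment ?m ?n" ?m ?n g S] T g continuous_on_subset[OF g(1) T(2)]
    by blast
  ultimately have "singular_relboundary 1 (top_of_set S) {}
     ((e a ?m + e ?m ?c - e a ?c) + (e b ?n + e ?n ?d - e b ?d) + (e ?n ?m - - e ?m ?n))"
    unfolding homologous_rel_def by (intro singular_relboundary_add)
  also have "(e a ?m + e ?m ?c - e a ?c) + (e b ?n + e ?n ?d - e b ?d) + (e ?n ?m - - e ?m ?n) =
     rect_boundary g a ?n + rect_boundary g ?m b - rect_boundary g a b"
    by (simp add: rect_boundary_def e_def algebra_simps)
  finally show ?thesis
    by (subst homologous_rel_sym) (simp add: homologous_rel_def)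
qed

lemma rect_boundary_homologous_circle:
  assumes z: "z \<in> box a b" and \<delta>: "0 < \<delta>" "cball z \<delta> \<subseteq> cbox a b"
    and g: "continuous_on (cbox a b - {z}) g" "g ` (cbox a b - {z}) \<subseteq> S"
  shows "homologous S (rect_boundary g a b) (path_chain (g \<circ> circlepath z \<delta>))"
proof -
  have "homologous S (path_chain (g \<circ> rectpath a b)) (path_chain (g \<circ> circlepath z \<delta>))"
    using homotopic_loops_continuous_image[OF rectpath_homotopic_circlepath[OF z \<delta>] g(1)] g(2)
    by (intro homologous_homotopic_loops) blast
  moreover have "homologous S (path_chain (g \<circ> rectpath a b)) (rect_boundary g a b)"
  proof (rule homologous_rectpath)
    have "cbox a b - box a b \<subseteq> cbox a b - {z}"
      using z by blast
    then show "continuous_on (cbox a b - box a b) g" "g ` (cbox a b - box a b) \<subseteq> S"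
      using g continuous_on_subset by blast+
  qed (use z in \<open>auto simp: in_box_complex_iff\<close>)
  ultimately show ?thesis
    by (metis homologous_common homologous_rel_sym)
qed

text \<open>Induction on the number of points: a vertical line separates the rightmost point from the others and
divides the rectangle into a part with that point alone and a part with the remaining ones. Distinct real parts
make such a line exist. A radius that is small enough for both parts is small enough for the whole.\<close>

lemma rect_boundary_homologous_circles:
  assumes "finite F" "inj_on Re F" "F \<subseteq> box a b" "Re a < Re b" "Im a < Im b"
    and "continuous_on (cbox a b - F) g" "g ` (cbox a b - F) \<subseteq> S"
  shows "\<forall>\<^sub>F \<delta> in at_right 0. homologous S (rect_boundary g a b) (\<Sum>z\<in>F. path_chain (g \<circ> circlepath z \<delta>))"
  using assms
proof (induction F arbitrary: a b rule: finite_ranking_induct[where f = Re])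
  case empty
  then show ?case
    using rect_boundary_null_homologous[of a b g S] by simp
next
  case (insert z F)
  show ?case
  proof (cases "z \<in> F")
    case True
    then show ?thesis
      using insert.IH[of a b] insert.prems by (simp add: insert_absorb)
  next
    case False
    have left: "Re w < Re z" if "w \<in> F" for w
    proof -
      have "Re w \<noteq> Re z"
        using insert.prems(1) that False by (auto simp: inj_on_def)
      then show ?thesis
        using insert.hyps(2)[OF that] by simp
    qed
    have z: "z \<in> box a b"
      using insert.prems by auto
    define m where "m = Max (insert (Re a) (Re ` F))"
    have "m < Re z"
      using insert.hyps z left by (auto simp: m_def in_box_complex_iff)
    then obtain c where c: "m < c" "c < Re z"
      using dense by blast
    have m: "Re a \<le> m" "\<And>w. w \<in> F \<Longrightarrow> Re w \<le> m"
      using insert.hyps by (auto simp: m_def)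
    let ?b = "Complex c (Im b)" and ?a = "Complex c (Im a)"
    have c': "Re a < c" "c < Re b" "\<And>w. w \<in> F \<Longrightarrow> Re w < c"
      using c m z by (force simp: in_box_complex_iff)+
    have L: "cbox a ?b - F \<subseteq> cbox a b - insert z F" and R: "cbox ?a b - {z} \<subseteq> cbox a b - insert z F"
      using c c' by (force simp: in_cbox_complex_iff)+
    have gL: "continuous_on (cbox a ?b - F) g" "g ` (cbox a ?b - F) \<subseteq> S"
      using continuous_on_subset[OF insert.prems(5) L] insert.prems(6) L by blast+
    have gR: "continuous_on (cbox ?a b - {z}) g" "g ` (cbox ?a b - {z}) \<subseteq> S"
      using continuous_on_subset[OF insert.prems(5) R] insert.prems(6) R by blast+
    have FL: "F \<subseteq> box a ?b"
      using c' insert.prems by (force simp: in_box_complex_iff)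
    have zR: "z \<in> box ?a b"
      using c z by (auto simp: in_box_complex_iff)
    have IH: "\<forall>\<^sub>F \<delta> in at_right 0. homologous S (rect_boundary g a ?b) (\<Sum>w\<in>F. path_chain (g \<circ> circlepath w \<delta>))"
      using FL gL c' insert.prems
      by (intro insert.IH) (auto intro: inj_on_subset)
    obtain e where e: "e > 0" "cball z e \<subseteq> cbox ?a b"
      using zR open_box[of ?a b] box_subset_cbox by (metis open_contains_cball subset_trans)
    then have small: "\<forall>\<^sub>F \<delta> in at_right 0. \<delta> < e"
      using eventually_at_right_less eventually_at_right_real by (metis (mono_tags, lifting) eventually_mono greaterThanLessThan_iff)
    have pos: "\<forall>\<^sub>F \<delta> in at_right (0::real). 0 < \<delta>"
      by (simp add: eventually_at_right_less)
    have cut: "homologous S (rect_boundary g a b) (rect_boundary g a ?b + rect_boundary g ?a b)"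
    proof (rule rect_boundary_cut[where T = "cbox a b - insert z F"])
      show "closed_segment ?a ?b \<subseteq> cbox a b - insert z F"
        using c c' insert.prems
        by (auto simp: closed_segment_same_Re in_cbox_complex_iff closed_segment_eq_real_ivl)
    qed (use c' insert.prems in auto)
    from IH small pos show ?thesis
    proof eventually_elim
      case (elim \<delta>)
      have "homologous S (rect_boundary g ?a b) (path_chain (g \<circ> circlepath z \<delta>))"
        using elim e zR gR
        by (intro rect_boundary_homologous_circle) (auto dest: subset_cball[of _ _ z])
      with elim have "homologous S (rect_boundary g a ?b + rect_boundary g ?a b)
         ((\<Sum>w\<in>F. path_chain (g \<circ> circlepath w \<delta>)) + path_chain (g \<circ> circlepath z \<delta>))"
        by (intro homologous_rel_add)
      then have "homologous S (rect_boundary g a b)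
         ((\<Sum>w\<in>F. path_chain (g \<circ> circlepath w \<delta>)) + path_chain (g \<circ> circlepath z \<delta>))"
        using cut by (rule homologous_rel_trans)
      then show ?case
        using insert.hyps left by (subst sum.insert) (auto simp: add.commute)
    qed
  qed
qed

section \<open>Complex lines and normalised linear forms\<close>

definition lform :: "complex ^ 'n \<Rightarrow> complex ^ 'n \<Rightarrow> complex" where
  "lform c z = (\<Sum>i\<in>UNIV. c $ i * z $ i)"

definition cline :: "complex ^ 'n \<Rightarrow> complex ^ 'n \<Rightarrow> complex \<Rightarrow> complex ^ 'n" where
  "cline p u w = p + w *s u"

lemma lform_add [simp]: "lform c (y + z) = lform c y + lform c z"
  by (simp add: lform_def distrib_left sum.distrib)

lemma lform_scaleR [simp]: "lform c (s *\<^sub>R z) = of_real s * lform c z"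
  by (simp add: lform_def scaleR_sum_right flip: scaleR_conv_of_real)

lemma lform_minus [simp]: "lform c (- z) = - lform c z"
  using lform_scaleR[of c "-1" z] by simp

lemma lform_diff [simp]: "lform c (y - z) = lform c y - lform c z"
  using lform_add[of c y "- z"] by simp

lemma lform_smult [simp]: "lform c (w *s z) = w * lform c z"
  by (simp add: lform_def sum_distrib_left mult_ac)

lemma lform_left_smult [simp]: "lform (w *s c) z = w * lform c z"
  by (simp add: lform_def sum_distrib_left mult_ac)

lemma lform_zero [simp]: "lform c 0 = 0"
  by (simp add: lform_def)

lemma lform_cline [simp]: "lform c (cline p u w) = lform c p + w * lform c u"
  by (simp add: cline_def)

lemma continuous_on_lform [continuous_intros]:
  "continuous_on S f \<Longrightarrow> continuous_on S (\<lambda>t. lform c (f t))"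
  unfolding lform_def by (intro continuous_intros)

lemma norm_smult_vec: "norm (w *s z) = cmod w * norm (z :: complex ^ 'n)"
  by (simp add: norm_vec_def L2_set_def norm_mult power_mult_distrib flip: sum_distrib_left real_sqrt_mult)
    (simp add: real_sqrt_mult)

lemma continuous_on_smult_vec [continuous_intros]:
  fixes f :: "'a::topological_space \<Rightarrow> complex" and g :: "'a \<Rightarrow> complex ^ 'n"
  assumes "continuous_on S f" "continuous_on S g"
  shows "continuous_on S (\<lambda>t. f t *s g t)"
  unfolding vector_scalar_mult_def by (intro continuous_intros assms)

lemma continuous_on_cline [continuous_intros]:
  "continuous_on S p \<Longrightarrow> continuous_on S f \<Longrightarrow> continuous_on S (\<lambda>t. cline (p t) u (f t))"
  unfolding cline_def by (intro continuous_intros)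

lemma cline_circlepath: "cline p u \<circ> circlepath z \<delta> = cline (cline p u z) u \<circ> circlepath 0 \<delta>"
  by (auto simp: cline_def circlepath vec_eq_iff algebra_simps)

lemma hopf_loop_eq: "hopf_loop u = cline 0 u \<circ> circlepath 0 1"
  by (auto simp: hopf_loop_def cline_def circlepath)

lemma norm_circlepath: "0 \<le> \<delta> \<Longrightarrow> cmod (circlepath 0 \<delta> t) = \<delta>"
  by (simp add: circlepath norm_mult)

lemma eventually_small_multiple:
  fixes c r :: real
  assumes "0 < r"
  shows "\<forall>\<^sub>F \<delta> in at_right 0. \<delta> * c < r"
proof (rule order_tendstoD)
  show "((\<lambda>\<delta>. \<delta> * c) \<longlongrightarrow> 0) (at_right 0)"
    by (auto intro!: tendsto_eq_intros)
qed (use assms in auto)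

lemma linear_form_inner: "Re (lform c z) = (\<chi> i. cnj (c $ i)) \<bullet> z"
  by (simp add: lform_def inner_vec_def inner_complex_def)

text \<open>Dividing a defining form of \<open>H\<close> by its value at \<open>u\<close> makes it unique and makes all forms agree on the direction
\<open>u\<close> of the circles.\<close>

locale normalised_arrangement =
  fixes A :: "(complex ^ 'n) set set" and u :: "complex ^ 'n" and b :: "(complex ^ 'n) set \<Rightarrow> complex ^ 'n"
  assumes finite_arr: "finite A"
    and hyperplane: "\<And>H. H \<in> A \<Longrightarrow> H = {z. lform (b H) z = 0}"
    and normalised: "\<And>H. H \<in> A \<Longrightarrow> lform (b H) u = 1"
begin

abbreviation M where "M \<equiv> arr_complement A"

lemma mem_hyperplane: "H \<in> A \<Longrightarrow> z \<in> H \<longleftrightarrow> lform (b H) z = 0"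
  using hyperplane by blast

lemma closed_hyperplane: "H \<in> A \<Longrightarrow> closed H"
  by (subst hyperplane) (auto intro!: closed_Collect_eq continuous_intros)

text \<open>Subtracting from \<open>z\<close> its component along \<open>u\<close> gives a point of \<open>H\<close>, hence of \<open>H'\<close>; so the two
normalised forms agree at \<open>z\<close>.\<close>

lemma hyperplane_subset_eq:
  assumes "H \<in> A" "H' \<in> A" "H \<subseteq> H'"
  shows "H = H'"
proof -
  have "lform (b H') z = lform (b H) z" for z
  proof -
    have "z - lform (b H) z *s u \<in> H"
      using assms by (simp add: mem_hyperplane normalised)
    then have "z - lform (b H) z *s u \<in> H'"
      using assms by blast
    then show ?thesis
      using assms by (simp add: mem_hyperplane normalised)
  qed
  then show ?thesis
    using assms by (auto simp: mem_hyperplane)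
qed

lemma hyperplanes_separated:
  assumes "compact K" "\<And>H p. H \<in> B \<Longrightarrow> p \<in> K \<Longrightarrow> p \<notin> H" "B \<subseteq> A"
  obtains \<rho> where "\<rho> > 0" "\<And>H p v. H \<in> B \<Longrightarrow> p \<in> K \<Longrightarrow> norm v < \<rho> \<Longrightarrow> p + v \<notin> H"
proof -
  have "closed (\<Union>B)"
    using assms finite_arr closed_hyperplane finite_subset by (intro closed_Union) blast+
  moreover have "K \<inter> \<Union>B = {}"
    using assms by blast
  ultimately obtain \<rho> where \<rho>: "\<rho> > 0" "\<And>p q. p \<in> K \<Longrightarrow> q \<in> \<Union>B \<Longrightarrow> \<rho> \<le> dist p q"
    using separate_compact_closed[OF assms(1)] by metis
  have "p + v \<notin> H" if "H \<in> B" "p \<in> K" "norm v < \<rho>" for H p v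
    using \<rho>(2)[of p "p + v"] that by (auto simp: dist_norm)
  with \<rho>(1) show thesis
    using that by blast
qed

text \<open>While the centre moves inside a stratum, a hyperplane that contains the centre sees only the nonzero term
\<open>\<delta> * exp (2 * pi * \<i> * t)\<close>, and a hyperplane that avoids the compact path of centres has positive distance to it.\<close>

lemma small_circles_homotopic:
  fixes p :: "real \<Rightarrow> complex ^ 'n"
  assumes p: "path p"
    and stratum: "\<And>H. H \<in> A \<Longrightarrow> path_image p \<subseteq> H \<or> path_image p \<inter> H = {}"
  shows "\<forall>\<^sub>F \<delta> in at_right 0.
    homotopic_loops M (cline (p 0) u \<circ> circlepath 0 \<delta>) (cline (p 1) u \<circ> circlepath 0 \<delta>)"
proof -
  let ?B = "{H \<in> A. path_image p \<inter> H = {}}"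
  obtain \<rho> where \<rho>: "\<rho> > 0" "\<And>H q v. H \<in> ?B \<Longrightarrow> q \<in> path_image p \<Longrightarrow> norm v < \<rho> \<Longrightarrow> q + v \<notin> H"
    using hyperplanes_separated[of "path_image p" ?B] p compact_path_image by blast
  have "\<forall>\<^sub>F \<delta> in at_right 0. \<delta> * norm u < \<rho>"
    using \<rho>(1) by (rule eventually_small_multiple)
  moreover have "\<forall>\<^sub>F \<delta> in at_right (0::real). 0 < \<delta>"
    by (simp add: eventually_at_right_less)
  ultimately show ?thesis
  proof eventually_elim
    case (elim \<delta>)
    define h where "h = (\<lambda>(s, t). cline (p s) u (circlepath 0 \<delta> t))"
    have "h (s, t) \<in> M" if st: "s \<in> {0..1}" for s t
    proof -
      have ps: "p s \<in> path_image p"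
        using st by (auto simp: path_image_def)
      have circ: "cmod (circlepath 0 \<delta> t) = \<delta>"
        using elim by (simp add: norm_circlepath)
      have "h (s, t) \<notin> H" if H: "H \<in> A" for H
        using stratum[OF H]
      proof
        assume "path_image p \<subseteq> H"
        then have "lform (b H) (p s) = 0"
          using ps H mem_hyperplane by blast
        then show ?thesis
          using circ elim H by (auto simp: h_def mem_hyperplane normalised)
      next
        assume "path_image p \<inter> H = {}"
        then show ?thesis
          using \<rho>(2)[of H "p s" "circlepath 0 \<delta> t *s u"] H ps circ elim
          by (simp add: h_def cline_def norm_smult_vec)
      qed
      then show ?thesis
        by (auto simp: arr_complement_def)
    qed
    moreover have "continuous_on ({0..1} \<times> {0..1}) h"
    proof -
      have "continuous_on ({0..1} \<times> {0..1}) (\<lambda>x. p (fst x))"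
        by (rule continuous_on_compose2[OF p[unfolded path_def]]) (auto intro: continuous_intros)
      then show ?thesis
        unfolding h_def case_prod_unfold circlepath by (intro continuous_intros)
    qed
    moreover have "h (s, 1) = h (s, 0)" for s
      by (simp add: h_def circlepath)
    ultimately show ?case
      unfolding homotopic_loops
      by (intro exI[of _ h]) (auto simp: h_def pathstart_def pathfinish_def)
  qed
qed

text \<open>The complex line through \<open>p\<close> and \<open>q\<close> lies in \<open>H\<close> and meets every other hyperplane in at most one point; the
complex plane minus finitely many points is path connected.\<close>

lemma meridians_homotopic:
  assumes H: "H \<in> A" and p: "p \<in> H" "\<And>H'. H' \<in> A \<Longrightarrow> H' \<noteq> H \<Longrightarrow> p \<notin> H'"
    and q: "q \<in> H" "\<And>H'. H' \<in> A \<Longrightarrow> H' \<noteq> H \<Longrightarrow> q \<notin> H'"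
  shows "\<forall>\<^sub>F \<delta> in at_right 0.
    homotopic_loops M (cline p u \<circ> circlepath 0 \<delta>) (cline q u \<circ> circlepath 0 \<delta>)"
proof -
  define Z where "Z H' = {w. lform (b H') (cline p (q - p) w) = 0}" for H'
  define W where "W = - (\<Union>H'\<in>A - {H}. Z H')"
  have "finite (Z H')" if H': "H' \<in> A - {H}" for H'
  proof -
    have nz: "lform (b H') p \<noteq> 0"
      using H' p(2) mem_hyperplane by blast
    have "Z H' \<subseteq> {- lform (b H') p / lform (b H') (q - p)}"
    proof
      fix w assume "w \<in> Z H'"
      then have eq: "lform (b H') p + w * lform (b H') (q - p) = 0"
        by (simp add: Z_def del: lform_diff)
      then have "lform (b H') (q - p) \<noteq> 0"
        using nz by auto
      then show "w \<in> {- lform (b H') p / lform (b H') (q - p)}"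
        using eq by (simp add: field_simps eq_neg_iff_add_eq_0 del: lform_diff)
    qed
    then show ?thesis
      using finite_subset by blast
  qed
  then have "countable (\<Union>H'\<in>A - {H}. Z H')"
    using finite_arr by (intro countable_finite finite_UN_I) auto
  then have conn: "path_connected W"
    unfolding W_def by (intro path_connected_complement_countable) auto
  have "0 \<in> W" "1 \<in> W"
    using p q mem_hyperplane by (auto simp: W_def Z_def)
  then obtain g where g: "path g" "path_image g \<subseteq> W" "pathstart g = 0" "pathfinish g = 1"
    using conn[unfolded path_connected_def, rule_format, of 0 1] by blast
  let ?p = "cline p (q - p) \<circ> g"
  have "path ?p"
    using g(1) by (auto intro!: path_continuous_image continuous_intros)
  moreover have "path_image ?p \<subseteq> H' \<or> path_image ?p \<inter> H' = {}" if "H' \<in> A" for H'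
  proof (cases "H' = H")
    case True
    then show ?thesis
      using p q H by (auto simp: path_image_compose mem_hyperplane)
  next
    case False
    have "x \<notin> H'" if x: "x \<in> path_image ?p" for x
    proof -
      obtain w where w: "x = cline p (q - p) w" "w \<in> path_image g"
        using x unfolding path_image_compose by blast
      then have "w \<notin> Z H'"
        using g(2) False \<open>H' \<in> A\<close> by (auto simp: W_def)
      then show ?thesis
        using w(1) \<open>H' \<in> A\<close> mem_hyperplane by (auto simp: Z_def)
    qed
    then show ?thesis
      by blast
  qed
  ultimately have "\<forall>\<^sub>F \<delta> in at_right 0.
    homotopic_loops M (cline (?p 0) u \<circ> circlepath 0 \<delta>) (cline (?p 1) u \<circ> circlepath 0 \<delta>)"
    by (rule small_circles_homotopic)
  then show ?thesis
    using g by (simp add: pathstart_def pathfinish_def cline_def)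
qed

text \<open>Two normalised forms have equal real part at \<open>v\<close> only on a real hyperplane of directions, and finitely many of these do not
cover the space. Distinct real parts are what the vertical cuts of a rectangle require.\<close>

lemma generic_direction: "\<exists>v. inj_on (\<lambda>H. Re (lform (b H) v)) A"
proof -
  define c where "c H = (\<chi> i. cnj (b H $ i))" for H
  define N where "N = (\<lambda>(H, H'). {v. (c H - c H') \<bullet> v = 0}) ` {(H, H'). H \<in> A \<and> H' \<in> A \<and> H \<noteq> H'}"
  have "finite {(H, H'). H \<in> A \<and> H' \<in> A \<and> H \<noteq> H'}"
    by (rule finite_subset[of _ "A \<times> A"]) (auto simp: finite_arr)
  then have "finite N"
    by (simp add: N_def)
  have distinct: "c H \<noteq> c H'" if "H \<in> A" "H' \<in> A" "H \<noteq> H'" for H H'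
  proof
    assume "c H = c H'"
    then have "b H = b H'"
      by (simp add: c_def vec_eq_iff)
    then have "H = H'"
      using that by (auto simp: mem_hyperplane)
    then show False
      using that by simp
  qed
  have "negligible T" if "T \<in> N" for T
  proof -
    obtain H H' where "H \<in> A" "H' \<in> A" "H \<noteq> H'" "T = {v. (c H - c H') \<bullet> v = 0}"
      using \<open>T \<in> N\<close> unfolding N_def by blast
    then show ?thesis
      using distinct[of H H'] negligible_hyperplane[of "c H - c H'" 0] by simp
  qed
  with \<open>finite N\<close> have "negligible (\<Union>N)"
    by blast
  then obtain v where "v \<notin> \<Union>N"
    using non_negligible_UNIV by (metis UNIV_eq_I)
  then have "inj_on (\<lambda>H. Re (lform (b H) v)) A"
    unfolding inj_on_def linear_form_inner c_def[symmetric]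
    by (auto simp: N_def inner_diff_left)
  then show ?thesis ..
qed

end

section \<open>The classes of the flats as classes of small circles\<close>

lemma thick_segment_convex_body:
  assumes "0 < \<epsilon>"
  shows "convex (thick_segment xV x \<epsilon>)" "compact (thick_segment xV x \<epsilon>)"
    "cball x \<epsilon> \<subseteq> thick_segment xV x \<epsilon>" "x \<in> interior (thick_segment xV x \<epsilon>)"
proof -
  have "thick_segment xV x \<epsilon> = (\<Union>a\<in>closed_segment xV x. \<Union>v\<in>cball 0 \<epsilon>. {a + v})"
    unfolding thick_segment_def by blast
  then show "convex (thick_segment xV x \<epsilon>)"
    by (simp add: convex_sums)
  show "compact (thick_segment xV x \<epsilon>)"
    unfolding thick_segment_def by (intro compact_sums) auto
  show ball: "cball x \<epsilon> \<subseteq> thick_segment xV x \<epsilon>"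
  proof
    fix y assume "y \<in> cball x \<epsilon>"
    then have "y = x + (y - x) \<and> x \<in> closed_segment xV x \<and> y - x \<in> cball 0 \<epsilon>"
      by (auto simp: dist_norm norm_minus_commute)
    then show "y \<in> thick_segment xV x \<epsilon>"
      unfolding thick_segment_def by blast
  qed
  show "x \<in> interior (thick_segment xV x \<epsilon>)"
    using ball assms by (auto simp: mem_interior_cball)
qed

lemma hurewicz_eq:
  assumes "c \<noteq> {}" "\<And>g. g \<in> c \<Longrightarrow> loop_homology_class S g = a"
  shows "hurewicz S c = a"
  unfolding hurewicz_def using assms by (intro the_equality) auto

lemma loop_homology_class_eq_iff:
  "loop_homology_class S g = loop_homology_class S h \<longleftrightarrow> homologous S (path_chain g) (path_chain h)"
  unfolding loop_homology_class_def by (rule homologous_rel_set_eq)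

context normalised_arrangement
begin

text \<open>The body \<open>thick_segment u x \<epsilon>\<close> misses the hyperplanes that do not contain \<open>X\<close>. A form that vanishes on \<open>X\<close>
vanishes at \<open>x\<close>, so the retraction along the segment to \<open>x\<close> multiplies its value by a positive factor.\<close>

lemma retraction_into_complement:
  assumes adm: "admissible_choice A u X x \<epsilon>"
  shows "radial_retraction x (thick_segment u x \<epsilon>) \<in> arr_complement (arr_localization A X) \<rightarrow> M"
proof
  let ?B = "thick_segment u x \<epsilon>" and ?r = "radial_retraction x (thick_segment u x \<epsilon>)"
  have \<epsilon>: "\<epsilon> > 0" and meet: "\<And>H. H \<in> A \<Longrightarrow> ?B \<inter> H \<noteq> {} \<longleftrightarrow> X \<subseteq> H" and xX: "x \<in> X"
    using adm by (auto simp: admissible_choice_def)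
  note B = thick_segment_convex_body[OF \<epsilon>, where xV = u and x = x]
  fix z assume z: "z \<in> arr_complement (arr_localization A X)"
  have rB: "?r z \<in> ?B"
    using radial_retraction_outside[OF B(1,4), of z] frontier_subset_compact[OF B(2)]
    by (cases "z \<in> ?B") auto
  have "?r z \<notin> H" if H: "H \<in> A" for H
  proof (cases "X \<subseteq> H")
    case False
    then show ?thesis
      using rB meet[OF H] by blast
  next
    case True
    then have zH: "lform (b H) z \<noteq> 0" and xH: "lform (b H) x = 0"
      using z xX H mem_hyperplane by (auto simp: arr_complement_def arr_localization_def)
    show ?thesis
    proof (cases "z \<in> ?B")
      case True
      then show ?thesis
        using zH H by (simp add: mem_hyperplane)
    next
      case False
      obtain s where s: "?r z = (1 - s) *\<^sub>R x + s *\<^sub>R z"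
        using radial_retraction_outside(1)[OF B(1,4) False] by (auto simp: in_segment)
      have "s \<noteq> 0"
      proof
        assume "s = 0"
        then have "x \<in> frontier ?B"
          using radial_retraction_outside(2)[OF B(1,4) False] s by simp
        then show False
          using B(4) by (simp add: frontier_def)
      qed
      then show ?thesis
        using zH xH H by (simp add: s mem_hyperplane)
    qed
  qed
  then show "?r z \<in> M"
    by (auto simp: arr_complement_def)
qed

text \<open>The centre moves from \<open>0\<close> to \<open>x\<close> inside every hyperplane of \<open>A'\<close>, while the radius goes linearly from \<open>1\<close> to
\<open>\<delta>\<close> and stays positive. Only the radius affects the values of the forms.\<close>

lemma hopf_loop_homotopic_small_circle:
  assumes "A' \<subseteq> A" "\<And>H. H \<in> A' \<Longrightarrow> x \<in> H" "0 < \<delta>"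
  shows "homotopic_loops (arr_complement A') (hopf_loop u) (cline x u \<circ> circlepath 0 \<delta>)"
proof -
  define h where "h = (\<lambda>(s, t). cline (of_real s *s x) u (circlepath 0 ((1 - s) + s * \<delta>) t))"
  have "h (s, t) \<in> arr_complement A'" if s: "s \<in> {0..1}" for s t
  proof -
    have "(1 - s) + s * \<delta> > 0"
      using s \<open>0 < \<delta>\<close> by (cases "s = 1") (auto intro: add_pos_nonneg)
    then have "cmod (circlepath 0 ((1 - s) + s * \<delta>) t) \<noteq> 0"
      using norm_circlepath[of "(1 - s) + s * \<delta>" t] by linarith
    then have "h (s, t) \<notin> H" if "H \<in> A'" for H
      using assms that by (auto simp: h_def mem_hyperplane normalised subset_iff)
    then show ?thesis
      by (auto simp: arr_complement_def)
  qed
  moreover have "continuous_on ({0..1} \<times> {0..1}) h"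
    unfolding h_def case_prod_unfold circlepath by (intro continuous_intros)
  moreover have "h (s, 1) = h (s, 0)" for s
    by (simp add: h_def circlepath)
  ultimately show ?thesis
    unfolding homotopic_loops
    by (intro exI[of _ h]) (auto simp: h_def pathstart_def pathfinish_def hopf_loop_eq)
qed

text \<open>A circle inside \<open>cball x \<epsilon>\<close> is fixed by the retraction, so the retraction of the homotopy from the Hopf loop
ends at the circle itself. The second claim records that the circle is a loop in the complement.\<close>

lemma homology_flat_small_circle:
  assumes adm: "admissible_choice A u X x \<epsilon>" and \<delta>: "0 < \<delta>" "\<delta> * norm u \<le> \<epsilon>"
  shows "homology_flat A u X x \<epsilon> = loop_homology_class M (cline x u \<circ> circlepath 0 \<delta>)"
    and "homotopic_loops M (cline x u \<circ> circlepath 0 \<delta>) (cline x u \<circ> circlepath 0 \<delta>)"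
proof -
  let ?r = "radial_retraction x (thick_segment u x \<epsilon>)" and ?C = "cline x u \<circ> circlepath 0 \<delta>"
  let ?MX = "arr_complement (arr_localization A X)"
  have \<epsilon>: "\<epsilon> > 0" and xX: "x \<in> X"
    using adm by (auto simp: admissible_choice_def)
  note B = thick_segment_convex_body[OF \<epsilon>, where xV = u and x = x]
  have r: "continuous_on ?MX ?r" "?r \<in> ?MX \<rightarrow> M"
    using continuous_on_radial_retraction[OF B(1,2,4)] continuous_on_subset retraction_into_complement[OF adm]
    by blast+
  have "?C t \<in> thick_segment u x \<epsilon>" for t
  proof -
    have "?C t \<in> cball x \<epsilon>"
      using \<delta> by (simp add: cline_def dist_norm norm_smult_vec norm_circlepath)
    then show ?thesis
      using B(3) by blast
  qed
  then have rC: "?r \<circ> ?C = ?C"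
    by (auto simp: fun_eq_iff)
  have hopf: "homotopic_loops ?MX (hopf_loop u) ?C"
    using xX \<delta>(1) by (intro hopf_loop_homotopic_small_circle) (auto simp: arr_localization_def)
  have r_hopf: "homotopic_loops M (?r \<circ> hopf_loop u) ?C"
    using homotopic_loops_continuous_image[OF hopf r] by (simp add: rC)
  then show "homotopic_loops M ?C ?C"
    using homotopic_loops_sym homotopic_loops_trans by blast
  note loop = homotopic_loops_imp_path[OF hopf] homotopic_loops_imp_loop[OF hopf] homotopic_loops_imp_subset[OF hopf]
  note r_loop = homotopic_loops_imp_path[OF r_hopf] homotopic_loops_imp_loop[OF r_hopf] homotopic_loops_imp_subset[OF r_hopf]
  show "homology_flat A u X x \<epsilon> = loop_homology_class M ?C"
    unfolding homology_flat_def
  proof (rule hurewicz_eq)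
    have "hopf_loop u \<in> pi1_class ?MX (hopf_loop u)" "?r \<circ> hopf_loop u \<in> pi1_class M (?r \<circ> hopf_loop u)"
      using loop r_loop by (simp_all add: pi1_class_def)
    then show "gamma_flat A u X x \<epsilon> \<noteq> {}"
      unfolding gamma_flat_def pi1_induced_def by blast
  next
    fix h assume "h \<in> gamma_flat A u X x \<epsilon>"
    then obtain g where g: "homotopic_paths ?MX (hopf_loop u) g" "homotopic_paths M (?r \<circ> g) h"
      unfolding gamma_flat_def pi1_induced_def pi1_class_def by blast
    have "homotopic_paths M (?r \<circ> hopf_loop u) h"
      using homotopic_paths_continuous_image[OF g(1) r] g(2) by (rule homotopic_paths_trans)
    then have "homotopic_loops M (?r \<circ> hopf_loop u) h"
      using r_loop homotopic_paths_imp_pathfinish by (intro homotopic_paths_imp_homotopic_loops) fastforce+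
    then have "homotopic_loops M h ?C"
      using r_hopf homotopic_loops_sym homotopic_loops_trans by blast
    then show "loop_homology_class M h = loop_homology_class M ?C"
      unfolding loop_homology_class_eq_iff by (rule homologous_homotopic_loops)
  qed
qed

section \<open>A small circle around a point of several hyperplanes\<close>

text \<open>The circle is replaced by the boundary of a square in the same line. A short push of the line in a generic direction
separates the hyperplanes through \<open>x\<close>: they meet the square in distinct interior points, and no hyperplane meets its boundary
at any stage. The pushed boundary is a sum of circles around these points, and each circle moves to \<open>q H\<close>.\<close>

lemma small_circle_homologous_meridians:
  assumes q: "\<And>H. H \<in> A \<Longrightarrow> x \<in> H \<Longrightarrow> q H \<in> H"
    "\<And>H H'. H \<in> A \<Longrightarrow> x \<in> H \<Longrightarrow> H' \<in> A \<Longrightarrow> H' \<noteq> H \<Longrightarrow> q H \<notin> H'"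
  shows "\<forall>\<^sub>F \<delta> in at_right 0. homologous M (path_chain (cline x u \<circ> circlepath 0 \<delta>))
    (\<Sum>H\<in>{H \<in> A. x \<in> H}. path_chain (cline (q H) u \<circ> circlepath 0 \<delta>))"
proof -
  let ?Ax = "{H \<in> A. x \<in> H}" and ?far = "{H \<in> A. x \<notin> H}"
  \<comment> \<open>The square has half side \<open>r\<close> and the push has length at most \<open>\<eta> * norm v\<close>. Each moves a point by less
     than half of \<open>\<rho>\<close>, which bounds the distance from \<open>x\<close> to the other hyperplanes from below, and \<open>\<eta>\<close> is so small compared with \<open>r\<close> that the
     hyperplanes through \<open>x\<close> still meet the square only in its interior.\<close>
  obtain \<rho> where "\<rho> > 0" "\<And>H p v. H \<in> ?far \<Longrightarrow> p \<in> {x} \<Longrightarrow> norm v < \<rho> \<Longrightarrow> p + v \<notin> H"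
    by (rule hyperplanes_separated[of "{x}" ?far]) auto
  then have \<rho>: "\<rho> > 0" "\<And>H v. H \<in> ?far \<Longrightarrow> norm v < \<rho> \<Longrightarrow> x + v \<notin> H"
    by blast+
  obtain v where v: "inj_on (\<lambda>H. Re (lform (b H) v)) A"
    using generic_direction by blast
  have "\<forall>\<^sub>F r in at_right 0. r * (2 * norm u) < \<rho> / 2 \<and> r > 0"
    using \<rho>(1) by (intro eventually_conj eventually_small_multiple) (auto simp: eventually_at_right_less)
  then obtain r where r: "r * (2 * norm u) < \<rho> / 2" "r > 0"
    using eventually_happens' trivial_limit_at_right_real by blast
  have "\<forall>\<^sub>F \<eta> in at_right 0. (\<forall>H\<in>A. \<eta> * cmod (lform (b H) v) < r) \<and> \<eta> * norm v < \<rho> / 2 \<and> \<eta> > 0"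
    using \<rho>(1) r finite_arr
    by (intro eventually_conj eventually_ball_finite ballI eventually_small_multiple)
      (auto simp: eventually_at_right_less)
  then obtain \<eta> where \<eta>: "\<And>H. H \<in> A \<Longrightarrow> \<eta> * cmod (lform (b H) v) < r" "\<eta> * norm v < \<rho> / 2" "\<eta> > 0"
    using eventually_happens' trivial_limit_at_right_real by blast
  define y where "y = x + \<eta> *\<^sub>R v"
  \<comment> \<open>The line \<open>cline y u\<close> meets \<open>H\<close> at parameter \<open>\<zeta> H\<close>.\<close>
  define \<zeta> where "\<zeta> H = - (of_real \<eta> * lform (b H) v)" for H
  let ?l = "Complex (-r) (-r)" and ?h = "Complex r r"
  have big: "r \<le> cmod w" if "w \<in> cbox ?l ?h - box ?l ?h" for w
    using that abs_Re_le_cmod[of w] abs_Im_le_cmod[of w]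
    by (auto simp: in_cbox_complex_iff in_box_complex_iff)
  have small: "cmod w \<le> 2 * r" if "w \<in> cbox ?l ?h" for w
    using that cmod_le[of w] by (auto simp: in_cbox_complex_iff)
  have far: "x + s *\<^sub>R (\<eta> *\<^sub>R v) + w *s u \<notin> H" if "H \<in> ?far" "s \<in> {0..1}" "w \<in> cbox ?l ?h" for H s w
  proof -
    have "cmod w * norm u \<le> 2 * r * norm u"
      using small[OF that(3)] by (rule mult_right_mono) simp
    moreover have "s * (\<eta> * norm v) \<le> \<eta> * norm v"
      using that(2) \<eta>(3) by (intro mult_left_le_one_le) auto
    moreover have "norm (s *\<^sub>R (\<eta> *\<^sub>R v)) = s * (\<eta> * norm v)"
      using that(2) \<eta>(3) by simp
    moreover have "2 * r * norm u < \<rho> / 2"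
      using r(1) by (simp add: mult_ac)
    ultimately have "norm (s *\<^sub>R (\<eta> *\<^sub>R v) + w *s u) < \<rho>"
      using norm_triangle_ineq[of "s *\<^sub>R (\<eta> *\<^sub>R v)" "w *s u"] \<eta>(2)
      unfolding norm_smult_vec by linarith
    then show ?thesis
      using \<rho>(2)[OF that(1)] by (simp add: add.assoc)
  qed
  have rect: "path_image (rectpath ?l ?h) = cbox ?l ?h - box ?l ?h"
    using r by (intro path_image_rectpath_cbox_minus_box) auto

  have shift: "homotopic_loops M (cline x u \<circ> rectpath ?l ?h) (cline y u \<circ> rectpath ?l ?h)"
  proof -
    define h where "h = (\<lambda>(s, t). cline (x + s *\<^sub>R (\<eta> *\<^sub>R v)) u (rectpath ?l ?h t))"
    have "h (s, t) \<in> M" if st: "s \<in> {0..1}" "t \<in> {0..1}" for s t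
    proof -
      have w: "rectpath ?l ?h t \<in> cbox ?l ?h - box ?l ?h"
        using st rect by (auto simp: path_image_def)
      have "h (s, t) \<notin> H" if H: "H \<in> A" for H
      proof (cases "x \<in> H")
        case False
        then show ?thesis
          using far[of H s "rectpath ?l ?h t"] w st H by (simp add: h_def cline_def)
      next
        case True
        have "cmod (s * (\<eta> * lform (b H) v)) < r"
        proof -
          have "s * (\<eta> * cmod (lform (b H) v)) \<le> \<eta> * cmod (lform (b H) v)"
            using st \<eta>(3) by (intro mult_left_le_one_le) auto
          moreover have "cmod (s * (\<eta> * lform (b H) v)) = s * (\<eta> * cmod (lform (b H) v))"
            using \<eta>(3) st by (simp add: norm_mult)
          ultimately show ?thesis
            using \<eta>(1)[OF H] by linarith
        qed
        then have "s * (\<eta> * lform (b H) v) + rectpath ?l ?h t \<noteq> 0"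
          using big[OF w] by (metis add_eq_0_iff norm_minus_cancel not_le)
        then show ?thesis
          using True H by (simp add: h_def mem_hyperplane normalised mult.assoc)
      qed
      then show ?thesis
        by (auto simp: arr_complement_def)
    qed
    moreover have "continuous_on ({0..1} \<times> {0..1}) h"
    proof -
      have "continuous_on ({0..1} \<times> {0..1}) (\<lambda>x. rectpath ?l ?h (snd x))"
        by (rule continuous_on_compose2[OF path_rectpath[unfolded path_def]]) (auto intro: continuous_intros)
      then show ?thesis
        unfolding h_def case_prod_unfold by (intro continuous_intros)
    qed
    moreover have "h (s, 1) = h (s, 0)" for s
      using pathstart_rectpath[of ?l ?h] pathfinish_rectpath[of ?l ?h]
      by (simp add: h_def pathstart_def pathfinish_def)
    ultimately show ?thesis
      unfolding homotopic_loops
      by (intro exI[of _ h]) (auto simp: h_def y_def pathstart_def pathfinish_def)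
  qed

  have cont: "continuous_on T (cline p u)" for p and T :: "complex set"
    by (intro continuous_intros)
  have img_x: "cline x u ` (cbox ?l ?h - {0}) \<subseteq> M"
  proof -
    have "cline x u w \<notin> H" if "w \<in> cbox ?l ?h - {0}" "H \<in> A" for w H
      using that far[of H 0 w] by (cases "x \<in> H") (auto simp: mem_hyperplane normalised cline_def)
    then show ?thesis
      by (auto simp: arr_complement_def)
  qed
  have img_y: "cline y u ` (cbox ?l ?h - \<zeta> ` ?Ax) \<subseteq> M"
  proof -
    have "cline y u w \<notin> H" if w: "w \<in> cbox ?l ?h - \<zeta> ` ?Ax" and H: "H \<in> A" for w H
    proof (cases "x \<in> H")
      case True
      then have "w \<noteq> \<zeta> H"
        using w H by blast
      then show ?thesis
        using True H by (auto simp: mem_hyperplane normalised y_def \<zeta>_def add_eq_0_iff)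
    next
      case False
      then show ?thesis
        using far[of H 1 w] w H by (simp add: cline_def y_def)
    qed
    then show ?thesis
      by (auto simp: arr_complement_def)
  qed
  have \<zeta>_box: "\<zeta> ` ?Ax \<subseteq> box ?l ?h"
  proof clarify
    fix H assume "H \<in> A"
    then have "cmod (\<zeta> H) < r"
      using \<eta> by (simp add: \<zeta>_def norm_mult)
    then show "\<zeta> H \<in> box ?l ?h"
      using abs_Re_le_cmod[of "\<zeta> H"] abs_Im_le_cmod[of "\<zeta> H"] by (auto simp: in_box_complex_iff)
  qed
  have inj: "inj_on (Re \<circ> \<zeta>) ?Ax"
    using v \<eta>(3) by (auto simp: inj_on_def \<zeta>_def)
  have y_meets_only: "cline y u (\<zeta> H) \<in> H" "H' \<in> A \<Longrightarrow> H' \<noteq> H \<Longrightarrow> cline y u (\<zeta> H) \<notin> H'"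
    if H: "H \<in> ?Ax" for H H'
  proof -
    show "cline y u (\<zeta> H) \<in> H"
      using H by (auto simp: mem_hyperplane normalised y_def \<zeta>_def)
    assume H': "H' \<in> A" "H' \<noteq> H"
    show "cline y u (\<zeta> H) \<notin> H'"
    proof (cases "x \<in> H'")
      case True
      have "lform (b H') v \<noteq> lform (b H) v"
        using v H H' unfolding inj_on_def by (metis mem_Collect_eq)
      then show ?thesis
        using True H' \<eta>(3) by (auto simp: mem_hyperplane normalised y_def \<zeta>_def)
    next
      case False
      have "\<zeta> H \<in> cbox ?l ?h"
        using H \<zeta>_box box_subset_cbox by blast
      then show ?thesis
        using far[of H' 1 "\<zeta> H"] False H' by (simp add: cline_def y_def)
    qed
  qed

  have shifted: "homologous M (rect_boundary (cline x u) ?l ?h) (rect_boundary (cline y u) ?l ?h)"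
  proof -
    have "homologous M (path_chain (cline x u \<circ> rectpath ?l ?h)) (rect_boundary (cline x u) ?l ?h)"
    proof (rule homologous_rectpath)
      have "cbox ?l ?h - box ?l ?h \<subseteq> cbox ?l ?h - {0}"
        using big r by force
      then show "cline x u ` (cbox ?l ?h - box ?l ?h) \<subseteq> M"
        using img_x by blast
    qed (use r cont in auto)
    moreover have "homologous M (path_chain (cline y u \<circ> rectpath ?l ?h)) (rect_boundary (cline y u) ?l ?h)"
    proof (rule homologous_rectpath)
      show "cline y u ` (cbox ?l ?h - box ?l ?h) \<subseteq> M"
        using img_y \<zeta>_box by blast
    qed (use r cont in auto)
    ultimately show ?thesis
      using homologous_homotopic_loops[OF shift] by (metis homologous_common homologous_rel_sym)
  qed
  have range: "\<forall>\<^sub>F \<delta> in at_right 0. \<delta> \<in> {0<..<r}"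
    using r by (intro eventually_at_right_real) auto
  have circles: "\<forall>\<^sub>F \<delta> in at_right 0. homologous M (rect_boundary (cline y u) ?l ?h)
      (\<Sum>z\<in>\<zeta> ` ?Ax. path_chain (cline y u \<circ> circlepath z \<delta>))"
    using finite_arr \<zeta>_box img_y cont r inj
    by (intro rect_boundary_homologous_circles) (auto intro: inj_on_imageI)
  have meridians: "\<forall>\<^sub>F \<delta> in at_right 0. \<forall>H\<in>?Ax.
      homotopic_loops M (cline (cline y u (\<zeta> H)) u \<circ> circlepath 0 \<delta>) (cline (q H) u \<circ> circlepath 0 \<delta>)"
  proof (intro eventually_ball_finite ballI)
    fix H assume "H \<in> ?Ax"
    then show "\<forall>\<^sub>F \<delta> in at_right 0.
        homotopic_loops M (cline (cline y u (\<zeta> H)) u \<circ> circlepath 0 \<delta>) (cline (q H) u \<circ> circlepath 0 \<delta>)"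
      using q y_meets_only by (intro meridians_homotopic[of H]) blast+
  qed (use finite_arr in auto)
  from range circles meridians show ?thesis
  proof eventually_elim
    case (elim \<delta>)
    have "cball 0 \<delta> \<subseteq> cbox ?l ?h"
    proof
      fix w :: complex assume "w \<in> cball 0 \<delta>"
      then show "w \<in> cbox ?l ?h"
        using elim(1) abs_Re_le_cmod[of w] abs_Im_le_cmod[of w] by (auto simp: in_cbox_complex_iff)
    qed
    then have "homologous M (rect_boundary (cline x u) ?l ?h) (path_chain (cline x u \<circ> circlepath 0 \<delta>))"
      using elim(1) r img_x cont
      by (intro rect_boundary_homologous_circle) (auto simp: in_box_complex_iff)
    then have 1: "homologous M (path_chain (cline x u \<circ> circlepath 0 \<delta>)) (rect_boundary (cline y u) ?l ?h)"
      using shifted by (metis homologous_common homologous_rel_sym)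
    have at_points: "(\<Sum>z\<in>\<zeta> ` ?Ax. path_chain (cline y u \<circ> circlepath z \<delta>)) =
        (\<Sum>H\<in>?Ax. path_chain (cline (cline y u (\<zeta> H)) u \<circ> circlepath 0 \<delta>))"
      unfolding cline_circlepath[of y u _ \<delta>, symmetric]
      using inj by (intro sum.reindex_cong[of \<zeta>]) (auto intro: inj_on_imageI2)
    have moved: "homologous M (\<Sum>H\<in>?Ax. path_chain (cline (cline y u (\<zeta> H)) u \<circ> circlepath 0 \<delta>))
        (\<Sum>H\<in>?Ax. path_chain (cline (q H) u \<circ> circlepath 0 \<delta>))"
      using finite_arr elim(3) by (intro homologous_rel_sum homologous_homotopic_loops) auto
    show ?case
      by (rule homologous_rel_trans[OF moved homologous_rel_trans[OF elim(2)[unfolded at_points] 1]])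
  qed
qed

end

theorem corollary4p5:
  fixes A :: "(complex ^ 'n) set set"
    and xV :: "complex ^ 'n"
    and x :: "(complex ^ 'n) set \<Rightarrow> complex ^ 'n"
    and \<epsilon> :: "(complex ^ 'n) set \<Rightarrow> real"
    and X :: "(complex ^ 'n) set"
  assumes "arrangement A" and "central_arr A" and "essential_arr A"
    and "xV \<in> arr_complement A"
    and "\<And>Y. Y \<in> flats A \<Longrightarrow> admissible_choice A xV Y (x Y) (\<epsilon> Y)"
    and "X \<in> flats A"
  shows "homology_flat A xV X (x X) (\<epsilon> X) =
    finprod (homology_group 1 (top_of_set (arr_complement A)))
      (\<lambda>H. homology_flat A xV H (x H) (\<epsilon> H)) {H \<in> A. X \<subseteq> H}"
proof -
  have "\<exists>c. H = {z. lform c z = 0} \<and> lform c xV = 1" if H: "H \<in> A" for H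
  proof -
    obtain a c where "H = {z. lform a z = c}"
      using assms(1) H unfolding arrangement_def complex_hyperplane_def lform_def by blast
    moreover have "0 \<in> H"
      using assms(2) H by (simp add: central_arr_def)
    ultimately have a: "H = {z. lform a z = 0}"
      by auto
    have "xV \<notin> H"
      using assms(4) H by (auto simp: arr_complement_def)
    then have "lform a xV \<noteq> 0"
      using a by simp
    then show ?thesis
      using a by (intro exI[of _ "inverse (lform a xV) *s a"]) auto
  qed
  then obtain b where b: "\<And>H. H \<in> A \<Longrightarrow> H = {z. lform (b H) z = 0}" "\<And>H. H \<in> A \<Longrightarrow> lform (b H) xV = 1"
    by metis
  interpret normalised_arrangement A xV b
    using assms(1) b by unfold_locales (auto simp: arrangement_def)
  let ?AX = "{H \<in> A. X \<subseteq> H}" and ?C = "\<lambda>\<delta> p. cline p xV \<circ> circlepath 0 \<delta>"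
  have flat: "H \<in> flats A" if "H \<in> A" for H
    using that unfolding flats_def by (intro CollectI exI[of _ "{H}"]) auto
  have adm_X: "admissible_choice A xV X (x X) (\<epsilon> X)"
    using assms(5,6) by blast
  have adm: "admissible_choice A xV H (x H) (\<epsilon> H)" if "H \<in> A" for H
    using assms(5) flat that by blast
  have AX: "?AX = {H \<in> A. x X \<in> H}"
    using adm_X by (auto simp: admissible_choice_def)
  have ev1: "\<forall>\<^sub>F \<delta> in at_right 0. homologous M (path_chain (?C \<delta> (x X)))
      (\<Sum>H\<in>?AX. path_chain (?C \<delta> (x H)))"
    unfolding AX
  proof (rule small_circle_homologous_meridians)
    show "x H \<in> H" if "H \<in> A" for H
      using adm[OF that] by (simp add: admissible_choice_def)
    show "x H \<notin> H'" if "H \<in> A" "H' \<in> A" "H' \<noteq> H" for H H'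
      using adm[OF that(1)] hyperplane_subset_eq[OF that(1,2)] that by (auto simp: admissible_choice_def)
  qed
  have ev2: "\<forall>\<^sub>F \<delta> in at_right 0. \<forall>Y\<in>insert X A. \<delta> * norm xV < \<epsilon> Y"
    using finite_arr adm_X adm
    by (intro eventually_ball_finite ballI eventually_small_multiple) (auto simp: admissible_choice_def)
  have ev3: "\<forall>\<^sub>F \<delta> in at_right (0::real). 0 < \<delta>"
    by (simp add: eventually_at_right_less)
  obtain \<delta> where \<delta>: "homologous M (path_chain (?C \<delta> (x X))) (\<Sum>H\<in>?AX. path_chain (?C \<delta> (x H)))"
    "\<And>Y. Y \<in> insert X A \<Longrightarrow> \<delta> * norm xV \<le> \<epsilon> Y" "0 < \<delta>"
    using eventually_happens'[OF trivial_limit_at_right_real eventually_conj[OF ev1 eventually_conj[OF ev2 ev3]]]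
    using less_imp_le by blast
  have flat_H: "homology_flat A xV H (x H) (\<epsilon> H) = homologous_rel_set 1 (top_of_set M) {} (path_chain (?C \<delta> (x H)))"
    "singular_relcycle 1 (top_of_set M) {} (path_chain (?C \<delta> (x H)))" if "H \<in> ?AX" for H
  proof -
    have H: "H \<in> A" "\<delta> * norm xV \<le> \<epsilon> H"
      using that \<delta>(2) by auto
    show "homology_flat A xV H (x H) (\<epsilon> H) = homologous_rel_set 1 (top_of_set M) {} (path_chain (?C \<delta> (x H)))"
      using homology_flat_small_circle(1)[OF adm[OF H(1)] \<delta>(3) H(2)] by (simp add: loop_homology_class_def)
    show "singular_relcycle 1 (top_of_set M) {} (path_chain (?C \<delta> (x H)))"
      using homology_flat_small_circle(2)[OF adm[OF H(1)] \<delta>(3) H(2)]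
      by (intro singular_relcycle_loop) (auto simp: homotopic_loops_refl)
  qed
  have "homology_flat A xV X (x X) (\<epsilon> X) = homologous_rel_set 1 (top_of_set M) {} (path_chain (?C \<delta> (x X)))"
    using homology_flat_small_circle(1)[OF adm_X \<delta>(3)] \<delta>(2) by (simp add: loop_homology_class_def)
  also have "\<dots> = homologous_rel_set 1 (top_of_set M) {} (\<Sum>H\<in>?AX. path_chain (?C \<delta> (x H)))"
    using \<delta>(1) unfolding homologous_rel_set_eq .
  also have "\<dots> = finprod (homology_group (int 1) (top_of_set M))
      (\<lambda>H. homologous_rel_set 1 (top_of_set M) {} (path_chain (?C \<delta> (x H)))) ?AX"
    using finite_arr flat_H(2) by (intro finprod_homology_classes[symmetric]) auto
  also have "\<dots> = finprod (homology_group (int 1) (top_of_set M)) (\<lambda>H. homology_flat A xV H (x H) (\<epsilon> H)) ?AX"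
  proof -
    interpret H1: comm_group "homology_group (int 1) (top_of_set M)"
      by (rule abelian_relative_homology_group)
    show ?thesis
      using flat_H
      by (intro H1.finprod_cong') (auto simp: carrier_relative_homology_group simp del: One_nat_def of_nat_1)
  qed
  finally show ?thesis
    by simp
qed

end
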